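(* Let $1 \rightarrow Q_8 \rightarrow G' \stackrel{q}{\rightarrow} G \rightarrow 1$ be a short exact sequence of groups, where $Q_8$ is the quaternion group of order $8$. For any commuting elements $\alpha, \beta$ of $G$, the set $$L(\alpha,\beta,q)=\{(a,b)\in G'\times G' \mid q(a)=\alpha,\ q(b)=\beta,\ ab=ba\}$$ has $0$, $8$, $16$, $24$, or $40$ elements.
   Context: $Q_8=\{\pm1,\pm i,\pm j,\pm k\}$ is the quaternion group. The groups $G$ and $G'$ are arbitrary (not necessarily finite). *)

theory Defs
  imports "HOL-Algebra.Algebra"
begin

text \<open>
  The quadruple \<open>(a, b, c, d)\<close> stands for the integer quaternion \<open>a + b i + c j + d k\<close>;
  the product below is Hamilton's, determined by \<open>i\<^sup>2 = j\<^sup>2 = k\<^sup>2 = i j k = -1\<close>.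
\<close>

type_synonym quat = "int \<times> int \<times> int \<times> int"

fun hamilton_mult :: "quat \<Rightarrow> quat \<Rightarrow> quat" where
  "hamilton_mult (a, b, c, d) (a', b', c', d') =
    (a * a' - b * b' - c * c' - d * d',
     a * b' + b * a' + c * d' - d * c',
     a * c' - b * d' + c * a' + d * b',
     a * d' + b * c' - c * b' + d * a')"

definition Q8 :: "quat monoid" where
  "Q8 = \<lparr> carrier = {(1, 0, 0, 0), (-1, 0, 0, 0), (0, 1, 0, 0), (0, -1, 0, 0),
                     (0, 0, 1, 0), (0, 0, -1, 0), (0, 0, 0, 1), (0, 0, 0, -1)},
          monoid.mult = hamilton_mult,
          one = (1, 0, 0, 0) \<rparr>"

lemma hamilton_mult_assoc:
  "hamilton_mult (hamilton_mult x y) z = hamilton_mult x (hamilton_mult y z)"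
  by (cases x; cases y; cases z) (simp add: algebra_simps)

lemma group_Q8: "group Q8"
proof (rule groupI)
  fix x y z
  assume "x \<in> carrier Q8" "y \<in> carrier Q8"
  then show "x \<otimes>\<^bsub>Q8\<^esub> y \<in> carrier Q8"
    by (auto simp: Q8_def)
  show "x \<otimes>\<^bsub>Q8\<^esub> y \<otimes>\<^bsub>Q8\<^esub> z = x \<otimes>\<^bsub>Q8\<^esub> (y \<otimes>\<^bsub>Q8\<^esub> z)"
    by (simp add: Q8_def hamilton_mult_assoc)
next
  fix x
  assume "x \<in> carrier Q8"
  then show "\<exists>y\<in>carrier Q8. y \<otimes>\<^bsub>Q8\<^esub> x = \<one>\<^bsub>Q8\<^esub>"
    by (auto simp: Q8_def)
qed (auto simp: Q8_def)

lemma order_Q8: "order Q8 = 8"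
  by (simp add: order_def Q8_def)

lemma Q8_relations:
  fixes i j k m :: quat
  defines "i \<equiv> (0, 1, 0, 0)" and "j \<equiv> (0, 0, 1, 0)" and "k \<equiv> (0, 0, 0, 1)"
    and "m \<equiv> (-1, 0, 0, 0)"
  shows "i \<otimes>\<^bsub>Q8\<^esub> i = m" "j \<otimes>\<^bsub>Q8\<^esub> j = m" "k \<otimes>\<^bsub>Q8\<^esub> k = m" "i \<otimes>\<^bsub>Q8\<^esub> j \<otimes>\<^bsub>Q8\<^esub> k = m"
  by (simp_all add: Q8_def i_def j_def k_def m_def)

text \<open>
  The library's \<open>exact_seq\<close> requires all groups of the sequence to live on one type,
  hence this definition with three independent element types.
\<close>

definition short_exact ::
  "('a, 'm) monoid_scheme \<Rightarrow> ('a \<Rightarrow> 'b) \<Rightarrow> ('b, 'n) monoid_scheme \<Rightarrow> ('b \<Rightarrow> 'c) \<Rightarrow>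
   ('c, 'p) monoid_scheme \<Rightarrow> bool" where
  "short_exact A f B g C \<longleftrightarrow>
     group_hom A B f \<and> group_hom B C g \<and>
     inj_on f (carrier A) \<and>
     f ` carrier A = kernel B C g \<and>
     g ` carrier B = carrier C"

definition commuting_lifts ::
  "('b, 'n) monoid_scheme \<Rightarrow> 'c \<Rightarrow> 'c \<Rightarrow> ('b \<Rightarrow> 'c) \<Rightarrow> ('b \<times> 'b) set" where
  "commuting_lifts G' \<alpha> \<beta> q =
     {(a, b) \<in> carrier G' \<times> carrier G'. q a = \<alpha> \<and> q b = \<beta> \<and> a \<otimes>\<^bsub>G'\<^esub> b = b \<otimes>\<^bsub>G'\<^esub> a}"

end

theory Submission
  imports Defs
begin

text \<open>
  Let \<open>N\<close> be the kernel of \<open>q\<close> and \<open>q b = \<beta>\<close>. Then \<open>N\<close> acts by conjugation on the fibre of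
  \<open>\<alpha>\<close>, \<open>b\<close> permutes the orbits, and \<open>card L(\<alpha>,\<beta>) = card N * k\<close>, where \<open>k\<close> is the number of
  orbits fixed by \<open>b\<close>. Taking \<open>\<beta> = 1\<close>, the fibre of \<open>\<alpha>\<close> has \<open>t = card L(\<alpha>,1) / card N\<close> orbits,
  and by the symmetry of \<open>L\<close> this is also the number of conjugacy classes of \<open>N\<close> fixed by a lift
  of \<open>\<alpha>\<close>. For \<open>N = Q8\<close> there are five classes, at least two of which (\<open>{1}\<close> and \<open>{-1}\<close>) are fixed.
  A permutation cannot move exactly one point, so \<open>t\<close> is \<open>2\<close>, \<open>3\<close> or \<open>5\<close>, and by the same
  principle \<open>k \<le> t\<close> is \<open>0\<close>, \<open>1\<close>, \<open>2\<close>, \<open>3\<close> or \<open>5\<close>.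
\<close>

section \<open>Fixed points of a permutation\<close>

text \<open>If \<open>z\<close> were the only moved point, then \<open>f z\<close>, being different
  from \<open>z\<close>, would be fixed, so \<open>f\<close> would take the same value at
  \<open>z\<close> and at \<open>f z\<close>, against injectivity.\<close>

lemma card_fixed_points_plus_1_neq_card:
  assumes "finite A" "inj_on f A" "f ` A \<subseteq> A"
  shows "card {x \<in> A. f x = x} + 1 \<noteq> card A"
proof
  let ?F = "{x \<in> A. f x = x}"
  assume "card ?F + 1 = card A"
  then have "card (A - ?F) = 1"
    using assms(1) by (subst card_Diff_subset) auto
  then obtain z where z: "A - ?F = {z}"
    by (auto simp: card_1_singleton_iff)
  then have "z \<in> A" "f z \<noteq> z" by blast+
  moreover have "f z \<in> A" using assms(3) \<open>z \<in> A\<close> by blast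
  ultimately have "f (f z) = f z" using z by blast
  then show False
    using assms(2) \<open>z \<in> A\<close> \<open>f z \<in> A\<close> \<open>f z \<noteq> z\<close> by (auto dest: inj_onD)
qed

section \<open>Conjugation in a group\<close>

context group
begin

definition conjugate :: "'a \<Rightarrow> 'a \<Rightarrow> 'a" where
  "conjugate g x = g \<otimes> x \<otimes> inv g"

lemma conjugate_closed [simp]:
  "g \<in> carrier G \<Longrightarrow> x \<in> carrier G \<Longrightarrow> conjugate g x \<in> carrier G"
  by (simp add: conjugate_def)

lemma conjugate_mult:
  "g \<in> carrier G \<Longrightarrow> k \<in> carrier G \<Longrightarrow> x \<in> carrier G \<Longrightarrow>
    conjugate (g \<otimes> k) x = conjugate g (conjugate k x)"
  by (simp add: conjugate_def m_assoc inv_mult_group)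

lemma conjugate_one [simp]: "x \<in> carrier G \<Longrightarrow> conjugate \<one> x = x"
  by (simp add: conjugate_def)

lemma conjugate_eq_self_iff:
  assumes "g \<in> carrier G" "x \<in> carrier G"
  shows "conjugate g x = x \<longleftrightarrow> x \<otimes> g = g \<otimes> x"
  unfolding conjugate_def using assms inv_solve_right'[of x "g \<otimes> x" g] by auto

lemma conjugate_inv_cancel [simp]:
  "g \<in> carrier G \<Longrightarrow> x \<in> carrier G \<Longrightarrow> conjugate (inv g) (conjugate g x) = x"
  by (simp flip: conjugate_mult)

lemma inj_on_conjugate: "g \<in> carrier G \<Longrightarrow> inj_on (conjugate g) (carrier G)"
  by (rule inj_on_inverseI[where g = "conjugate (inv g)"]) simp

end

section \<open>Orbits of the kernel on the fibres\<close>

context group_hom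
begin

definition fibre :: "'c \<Rightarrow> 'a set" where
  "fibre c = {x \<in> carrier G. h x = c}"

definition kernel_orbit :: "'a \<Rightarrow> 'a set" where
  "kernel_orbit x = (\<lambda>n. G.conjugate n x) ` kernel G H h"

text \<open>Over the identity the fibre is the kernel itself, so there these orbits are the
  conjugacy classes of the kernel.\<close>

definition kernel_orbits :: "'c \<Rightarrow> 'a set set" where
  "kernel_orbits c = kernel_orbit ` fibre c"

lemma kernel_carrier: "n \<in> kernel G H h \<Longrightarrow> n \<in> carrier G"
  by (simp add: kernel_def)

text \<open>Conjugation by \<open>g\<close> stays in a fibre exactly because the images commute; the
  relation between \<alpha> and \<beta> enters the proof through this fact.\<close>

lemma hom_conjugate:
  assumes "g \<in> carrier G" "x \<in> carrier G" "h g \<otimes>\<^bsub>H\<^esub> h x = h x \<otimes>\<^bsub>H\<^esub> h g"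
  shows "h (G.conjugate g x) = h x"
  using assms by (simp add: G.conjugate_def H.m_assoc)

lemma kernel_orbit_subset_fibre: "x \<in> fibre c \<Longrightarrow> kernel_orbit x \<subseteq> fibre c"
  by (auto simp: kernel_orbit_def fibre_def kernel_def hom_conjugate)

lemma kernel_orbit_self: "x \<in> carrier G \<Longrightarrow> x \<in> kernel_orbit x"
  unfolding kernel_orbit_def by (rule image_eqI[where x = \<one>]) (auto simp: kernel_def)

lemma kernel_orbit_conjugate:
  assumes "m \<in> kernel G H h" "x \<in> carrier G"
  shows "kernel_orbit (G.conjugate m x) = kernel_orbit x"
proof
  have m: "m \<in> carrier G" "h m = \<one>\<^bsub>H\<^esub>" using assms(1) by (auto simp: kernel_def)
  show "kernel_orbit (G.conjugate m x) \<subseteq> kernel_orbit x"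
  proof
    fix y assume "y \<in> kernel_orbit (G.conjugate m x)"
    then obtain n where n: "n \<in> kernel G H h" "y = G.conjugate n (G.conjugate m x)"
      by (auto simp: kernel_orbit_def)
    then have "y = G.conjugate (n \<otimes> m) x" "n \<otimes> m \<in> kernel G H h"
      using m assms(2) by (auto simp: G.conjugate_mult kernel_def)
    then show "y \<in> kernel_orbit x" by (auto simp: kernel_orbit_def)
  qed
  show "kernel_orbit x \<subseteq> kernel_orbit (G.conjugate m x)"
  proof
    fix y assume "y \<in> kernel_orbit x"
    then obtain n where n: "n \<in> kernel G H h" "y = G.conjugate n x"
      by (auto simp: kernel_orbit_def)
    then have "y = G.conjugate (n \<otimes> inv m) (G.conjugate m x)" "n \<otimes> inv m \<in> kernel G H h"
      using m assms(2) by (auto simp: G.conjugate_mult kernel_def)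
    then show "y \<in> kernel_orbit (G.conjugate m x)" by (auto simp: kernel_orbit_def)
  qed
qed

lemma kernel_orbit_eq:
  "y \<in> kernel_orbit x \<Longrightarrow> x \<in> carrier G \<Longrightarrow> kernel_orbit y = kernel_orbit x"
  by (auto simp: kernel_orbit_def[of x] kernel_orbit_conjugate)

text \<open>Normality of the kernel: conjugating by \<open>n\<close> and then by \<open>g\<close> is
  the same as conjugating by \<open>g\<close> and then by \<open>?m\<close>, which is again in the
  kernel.\<close>

lemma conjugate_image_kernel_orbit_subset:
  assumes "g \<in> carrier G" "x \<in> carrier G"
  shows "G.conjugate g ` kernel_orbit x \<subseteq> kernel_orbit (G.conjugate g x)"
proof
  fix y assume "y \<in> G.conjugate g ` kernel_orbit x"
  then obtain n where n: "n \<in> kernel G H h" "y = G.conjugate g (G.conjugate n x)"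
    by (auto simp: kernel_orbit_def)
  let ?m = "G.conjugate g n"
  have nc: "n \<in> carrier G" "h n = \<one>\<^bsub>H\<^esub>" using n by (auto simp: kernel_def)
  have "?m \<in> kernel G H h"
    using assms nc hom_conjugate[of g n] by (simp add: kernel_def)
  moreover have "?m \<otimes> g = g \<otimes> n"
    using assms nc by (simp add: G.conjugate_def G.m_assoc)
  then have "y = G.conjugate ?m (G.conjugate g x)"
    using n assms nc by (simp flip: G.conjugate_mult)
  ultimately show "y \<in> kernel_orbit (G.conjugate g x)" by (auto simp: kernel_orbit_def)
qed

lemma conjugate_image_kernel_orbit:
  assumes g: "g \<in> carrier G" and x: "x \<in> carrier G"
  shows "G.conjugate g ` kernel_orbit x = kernel_orbit (G.conjugate g x)"
proof (rule equalityI[OF conjugate_image_kernel_orbit_subset[OF g x]])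
  show "kernel_orbit (G.conjugate g x) \<subseteq> G.conjugate g ` kernel_orbit x"
  proof
    fix y assume y: "y \<in> kernel_orbit (G.conjugate g x)"
    then have "G.conjugate (inv g) y \<in> kernel_orbit x"
      using conjugate_image_kernel_orbit_subset[of "inv g" "G.conjugate g x"] g x by auto
    moreover have "y \<in> carrier G"
      using y g x by (auto simp: kernel_orbit_def kernel_def)
    then have "y = G.conjugate g (G.conjugate (inv g) y)"
      using g by (simp flip: G.conjugate_mult)
    ultimately show "y \<in> G.conjugate g ` kernel_orbit x" by blast
  qed
qed

text \<open>Puts the action of \<open>g\<close> on orbits into the form that
  \<open>card_fixed_points_plus_1_neq_card\<close> expects.\<close>

lemma conjugate_permutes_kernel_orbits:
  assumes "g \<in> carrier G" "h g \<otimes>\<^bsub>H\<^esub> c = c \<otimes>\<^bsub>H\<^esub> h g"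
  shows "inj_on ((`) (G.conjugate g)) (kernel_orbits c)"
    and "(`) (G.conjugate g) ` kernel_orbits c \<subseteq> kernel_orbits c"
proof -
  have "O' \<subseteq> carrier G" if "O' \<in> kernel_orbits c" for O'
    using that kernel_orbit_subset_fibre by (fastforce simp: kernel_orbits_def fibre_def)
  then have "inj_on ((`) (G.conjugate g)) (kernel_orbits c)"
    by (intro inj_onI) (metis G.inj_on_conjugate[OF assms(1)] inj_on_image_eq_iff)
  then show "inj_on ((`) (G.conjugate g)) (kernel_orbits c)" .
  show "(`) (G.conjugate g) ` kernel_orbits c \<subseteq> kernel_orbits c"
    using assms by (auto simp: kernel_orbits_def fibre_def conjugate_image_kernel_orbit hom_conjugate)
qed

lemma kernel_orbits_disjoint:
  assumes "A \<in> kernel_orbits c" "B \<in> kernel_orbits c" "A \<noteq> B"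
  shows "A \<inter> B = {}"
proof (rule ccontr)
  assume "A \<inter> B \<noteq> {}"
  then obtain y where "y \<in> A" "y \<in> B" by blast
  moreover have "O' = kernel_orbit y" if "O' \<in> kernel_orbits c" "y \<in> O'" for O'
    using that kernel_orbit_eq by (auto simp: kernel_orbits_def fibre_def)
  ultimately show False using assms by metis
qed

lemma Union_kernel_orbits: "\<Union> (kernel_orbits c) = fibre c"
proof
  show "\<Union> (kernel_orbits c) \<subseteq> fibre c"
    using kernel_orbit_subset_fibre by (auto simp: kernel_orbits_def)
  show "fibre c \<subseteq> \<Union> (kernel_orbits c)"
    using kernel_orbit_self by (auto simp: kernel_orbits_def fibre_def)
qed

text \<open>A nonempty fibre is a coset of the kernel, hence has its cardinality.\<close>

lemma bij_betw_kernel_fibre: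
  assumes "b \<in> fibre d"
  shows "bij_betw (\<lambda>n. n \<otimes> b) (kernel G H h) (fibre d)"
  using assms
  by (intro bij_betw_byWitness[where f' = "\<lambda>g. g \<otimes> inv b"])
    (auto simp: fibre_def kernel_def G.m_assoc)

text \<open>Two elements of one fibre differ by a kernel element, which does not change orbits. So
  the action on orbits depends only on \<open>d\<close>, not on the chosen lift.\<close>

lemma conjugate_fibre_kernel_orbit:
  assumes "b \<in> fibre d" "g \<in> fibre d" "x \<in> carrier G"
  shows "kernel_orbit (G.conjugate g x) = kernel_orbit (G.conjugate b x)"
proof -
  obtain n where n: "n \<in> kernel G H h" "g = n \<otimes> b"
    using bij_betw_kernel_fibre[OF assms(1)] assms(2) by (auto simp: bij_betw_def)
  then show ?thesis
    using assms by (auto simp: G.conjugate_mult fibre_def kernel_carrier kernel_orbit_conjugate)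
qed

text \<open>
  If \<open>b\<close> fixes the orbit of \<open>x\<close>, then \<open>g \<mapsto> g x g\<^sup>-\<^sup>1\<close> maps the fibre of \<open>d\<close> into that orbit, and
  its fibre over \<open>y\<close> is a translate of the centralizer of \<open>y\<close> in the fibre of \<open>d\<close>.
\<close>

lemma sum_centralizers_kernel_orbit:
  assumes fin: "finite (kernel G H h)" and b: "b \<in> fibre d" and x: "x \<in> carrier G"
  shows "(\<Sum>y\<in>kernel_orbit x. card {g \<in> fibre d. G.conjugate g y = y}) =
    (if G.conjugate b ` kernel_orbit x = kernel_orbit x then card (kernel G H h) else 0)"
proof (cases "G.conjugate b ` kernel_orbit x = kernel_orbit x")
  case True
  have bc: "b \<in> carrier G" using b by (simp add: fibre_def)
  have fb: "finite (fibre d)"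
    using bij_betw_finite[OF bij_betw_kernel_fibre[OF b]] fin by simp
  have into: "G.conjugate g x \<in> kernel_orbit x" if "g \<in> fibre d" for g
    using conjugate_fibre_kernel_orbit[OF b that x] True conjugate_image_kernel_orbit[OF bc x]
      kernel_orbit_self[of "G.conjugate g x"] that x by (simp add: fibre_def)
  have "card {g \<in> fibre d. G.conjugate g y = y} = card {g \<in> fibre d. G.conjugate g x = y}"
    if y: "y \<in> kernel_orbit x" for y
  proof -
    obtain m where m: "m \<in> kernel G H h" "y = G.conjugate m x"
      using y by (auto simp: kernel_orbit_def)
    have "bij_betw (\<lambda>g. g \<otimes> m) {g \<in> fibre d. G.conjugate g y = y}
        {g \<in> fibre d. G.conjugate g x = y}"
      using m x
      by (intro bij_betw_byWitness[where f' = "\<lambda>g. g \<otimes> inv m"])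
        (auto simp: fibre_def kernel_def G.m_assoc G.conjugate_mult)
    then show ?thesis by (rule bij_betw_same_card)
  qed
  then have "(\<Sum>y\<in>kernel_orbit x. card {g \<in> fibre d. G.conjugate g y = y}) =
      (\<Sum>y\<in>kernel_orbit x. card {g \<in> fibre d. G.conjugate g x = y})"
    by (rule sum.cong[OF refl])
  also have "\<dots> = card (fibre d)"
    using sum.group[of "fibre d" "kernel_orbit x" "\<lambda>g. G.conjugate g x" "\<lambda>_. 1::nat"] fb into fin
    by (auto simp: kernel_orbit_def)
  also have "\<dots> = card (kernel G H h)"
    using bij_betw_same_card[OF bij_betw_kernel_fibre[OF b]] by simp
  finally show ?thesis using True by simp
next
  case False
  have bc: "b \<in> carrier G" using b by (simp add: fibre_def)
  \<comment> \<open>A single \<open>g\<close> over \<open>d\<close> fixing \<open>y\<close> would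
    fix the orbit of \<open>y\<close>, and then so would \<open>b\<close>, which acts on orbits as
    \<open>g\<close> does.\<close>
  have "{g \<in> fibre d. G.conjugate g y = y} = {}" if y: "y \<in> kernel_orbit x" for y
  proof (rule ccontr)
    assume "{g \<in> fibre d. G.conjugate g y = y} \<noteq> {}"
    then obtain g where g: "g \<in> fibre d" "G.conjugate g y = y" by blast
    have yc: "y \<in> carrier G" using y x by (auto simp: kernel_orbit_def kernel_def)
    have "kernel_orbit y = kernel_orbit (G.conjugate b y)"
      using conjugate_fibre_kernel_orbit[OF b g(1) yc] g(2) by simp
    then show False
      using False kernel_orbit_eq[OF y x] conjugate_image_kernel_orbit[OF bc yc] by simp
  qed
  then have "(\<Sum>y\<in>kernel_orbit x. card {g \<in> fibre d. G.conjugate g y = y}) = 0"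
    by (intro sum.neutral ballI) (simp only: card.empty)
  then show ?thesis using False by simp
qed

section \<open>Counting commuting lifts by orbits\<close>

lemma commuting_lifts_conv_Sigma:
  "commuting_lifts G c d h = (SIGMA x:fibre c. {g \<in> fibre d. G.conjugate g x = x})"
  by (auto simp: commuting_lifts_def fibre_def G.conjugate_eq_self_iff)

lemma commuting_lifts_subset: "commuting_lifts G c d h \<subseteq> fibre c \<times> fibre d"
  by (auto simp: commuting_lifts_def fibre_def)

lemma finite_fibre:
  assumes "finite (kernel G H h)"
  shows "finite (fibre c)"
proof (cases "fibre c = {}")
  case False
  then show ?thesis
    using bij_betw_finite[OF bij_betw_kernel_fibre] assms by blast
qed simp

text \<open>Sum over the first component and group the sum by orbits: an orbit contributes the order
  of the kernel if \<open>b\<close> fixes it, and nothing otherwise.\<close>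

lemma card_commuting_lifts:
  assumes fin: "finite (kernel G H h)" and b: "b \<in> fibre d"
  shows "card (commuting_lifts G c d h) =
    card (kernel G H h) * card {O' \<in> kernel_orbits c. G.conjugate b ` O' = O'}"
proof -
  let ?S = "\<lambda>y. card {g \<in> fibre d. G.conjugate g y = y}"
  have fos: "finite (kernel_orbits c)"
    using finite_fibre[OF fin] by (simp add: kernel_orbits_def)
  have "card (commuting_lifts G c d h) = (\<Sum>y\<in>fibre c. ?S y)"
    unfolding commuting_lifts_conv_Sigma using finite_fibre[OF fin] by (subst card_SigmaI) auto
  also have "\<dots> = (\<Sum>O'\<in>kernel_orbits c. \<Sum>y\<in>O'. ?S y)"
    unfolding Union_kernel_orbits[symmetric] using fin kernel_orbits_disjoint
    by (subst sum.Union_disjoint) (auto simp: kernel_orbits_def kernel_orbit_def)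
  also have "\<dots> = (\<Sum>O'\<in>kernel_orbits c.
      if G.conjugate b ` O' = O' then card (kernel G H h) else 0)"
  proof (rule sum.cong[OF refl])
    fix O' assume "O' \<in> kernel_orbits c"
    then obtain x where "x \<in> carrier G" "O' = kernel_orbit x"
      by (auto simp: kernel_orbits_def fibre_def)
    then show "(\<Sum>y\<in>O'. ?S y) = (if G.conjugate b ` O' = O' then card (kernel G H h) else 0)"
      using sum_centralizers_kernel_orbit[OF fin b] by blast
  qed
  also have "\<dots> = (\<Sum>O'\<in>{O' \<in> kernel_orbits c. G.conjugate b ` O' = O'}. card (kernel G H h))"
    using fos by (rule sum.inter_filter[symmetric])
  finally show ?thesis by simp
qed

text \<open>The identity is a lift of the identity and fixes every orbit.\<close>

lemma card_commuting_lifts_one: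
  assumes fin: "finite (kernel G H h)"
  shows "card (commuting_lifts G c \<one>\<^bsub>H\<^esub> h) = card (kernel G H h) * card (kernel_orbits c)"
proof -
  have "G.conjugate \<one> ` O' = O'" if "O' \<in> kernel_orbits c" for O'
  proof -
    have "G.conjugate \<one> y = y" if "y \<in> O'" for y
    proof -
      have "y \<in> fibre c"
        using that \<open>O' \<in> kernel_orbits c\<close> Union_kernel_orbits[of c] by blast
      then show ?thesis by (simp add: fibre_def)
    qed
    then show ?thesis by simp
  qed
  then have "{O' \<in> kernel_orbits c. G.conjugate \<one> ` O' = O'} = kernel_orbits c" by blast
  then show ?thesis
    using card_commuting_lifts[OF fin, of \<one> "\<one>\<^bsub>H\<^esub>" c] by (simp add: fibre_def)
qed

lemma card_commuting_lifts_swap: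
  "card (commuting_lifts G c d h) = card (commuting_lifts G d c h)"
  by (rule bij_betw_same_card[of prod.swap])
    (auto intro!: bij_betw_byWitness[where f' = prod.swap] simp: commuting_lifts_def)

end

section \<open>Commuting pairs in the quaternion group\<close>

text \<open>The two central elements have centralizers of order 8 and the six others of order 4,
  giving 2 * 8 + 6 * 4.\<close>

lemma card_commuting_pairs_Q8:
  "card {(x, y) \<in> carrier Q8 \<times> carrier Q8. x \<otimes>\<^bsub>Q8\<^esub> y = y \<otimes>\<^bsub>Q8\<^esub> x} = 40"
proof -
  let ?C = "\<lambda>x. {y \<in> carrier Q8. x \<otimes>\<^bsub>Q8\<^esub> y = y \<otimes>\<^bsub>Q8\<^esub> x}"
  have "{(x, y) \<in> carrier Q8 \<times> carrier Q8. x \<otimes>\<^bsub>Q8\<^esub> y = y \<otimes>\<^bsub>Q8\<^esub> x} = Sigma (carrier Q8) ?C"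
    by auto
  moreover have "card (Sigma (carrier Q8) ?C) = (\<Sum>x\<in>carrier Q8. card (?C x))"
    by (rule card_SigmaI) (auto simp: Q8_def)
  \<comment> \<open>As a sum of zeros and ones over eight explicit elements, the count can be
    evaluated by the simplifier.\<close>
  moreover have "card (?C x) = (\<Sum>y\<in>carrier Q8.
      if hamilton_mult x y = hamilton_mult y x then 1 else 0)" for x
    by (subst sum.inter_filter[symmetric]) (simp_all add: Q8_def)
  ultimately show ?thesis by (simp add: Q8_def)
qed

theorem theorem1:
  fixes G' :: "('b, 'n) monoid_scheme" and G :: "('c, 'p) monoid_scheme"
    and \<iota> :: "quat \<Rightarrow> 'b" and q :: "'b \<Rightarrow> 'c" and \<alpha> \<beta> :: 'c
  assumes "short_exact Q8 \<iota> G' q G"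
    and "\<alpha> \<in> carrier G" and "\<beta> \<in> carrier G"
    and "\<alpha> \<otimes>\<^bsub>G\<^esub> \<beta> = \<beta> \<otimes>\<^bsub>G\<^esub> \<alpha>"
  shows "finite (commuting_lifts G' \<alpha> \<beta> q) \<and>
         card (commuting_lifts G' \<alpha> \<beta> q) \<in> {0, 8, 16, 24, 40}"
proof -
  interpret q: group_hom G' G q using assms(1) by (simp add: short_exact_def)
  interpret i: group_hom Q8 G' \<iota> using assms(1) by (simp add: short_exact_def)
  let ?N = "kernel G' G q"
  have inj: "inj_on \<iota> (carrier Q8)" and N: "?N = \<iota> ` carrier Q8"
    and surj: "q ` carrier G' = carrier G"
    using assms(1) by (auto simp: short_exact_def)
  have fin: "finite ?N" unfolding N by (simp add: Q8_def)
  have cardN: "card ?N = 8"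
    unfolding N using card_image[OF inj] order_Q8 by (simp add: order_def)
  obtain a where a: "a \<in> carrier G'" "q a = \<alpha>" using assms(2)
    unfolding surj[symmetric] by (elim imageE) auto
  obtain b where b: "b \<in> carrier G'" "q b = \<beta>" using assms(3)
    unfolding surj[symmetric] by (elim imageE) auto
  have fin_orbits: "finite (q.kernel_orbits c)" for c
    using q.finite_fibre[OF fin] by (simp add: q.kernel_orbits_def)

  \<comment> \<open>Pairs over the identity are the commuting pairs of the kernel, a copy of
    \<open>Q8\<close>; their number 40 = 8 * 5 yields the five classes without listing them.\<close>
  have "commuting_lifts G' \<one>\<^bsub>G\<^esub> \<one>\<^bsub>G\<^esub> q = map_prod \<iota> \<iota> `
      {(x, y) \<in> carrier Q8 \<times> carrier Q8. x \<otimes>\<^bsub>Q8\<^esub> y = y \<otimes>\<^bsub>Q8\<^esub> x}" (is "_ = _ ` ?P")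
  proof -
    have "commuting_lifts G' \<one>\<^bsub>G\<^esub> \<one>\<^bsub>G\<^esub> q =
        {(x, y) \<in> ?N \<times> ?N. x \<otimes>\<^bsub>G'\<^esub> y = y \<otimes>\<^bsub>G'\<^esub> x}"
      by (auto simp: commuting_lifts_def kernel_def)
    also have "\<dots> = map_prod \<iota> \<iota> ` {(x, y) \<in> carrier Q8 \<times> carrier Q8.
        \<iota> x \<otimes>\<^bsub>G'\<^esub> \<iota> y = \<iota> y \<otimes>\<^bsub>G'\<^esub> \<iota> x}"
      unfolding N by (auto simp: image_iff)
    also have "{(x, y) \<in> carrier Q8 \<times> carrier Q8. \<iota> x \<otimes>\<^bsub>G'\<^esub> \<iota> y = \<iota> y \<otimes>\<^bsub>G'\<^esub> \<iota> x} = ?P"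
    proof -
      have "\<iota> x \<otimes>\<^bsub>G'\<^esub> \<iota> y = \<iota> y \<otimes>\<^bsub>G'\<^esub> \<iota> x \<longleftrightarrow> x \<otimes>\<^bsub>Q8\<^esub> y = y \<otimes>\<^bsub>Q8\<^esub> x"
        if "x \<in> carrier Q8" "y \<in> carrier Q8" for x y
        using inj_on_eq_iff[OF inj, of "x \<otimes>\<^bsub>Q8\<^esub> y" "y \<otimes>\<^bsub>Q8\<^esub> x"] that by simp
      then show ?thesis by blast
    qed
    finally show ?thesis .
  qed
  moreover have "inj_on (map_prod \<iota> \<iota>) ?P"
    using map_prod_inj_on[OF inj inj] by (rule inj_on_subset) blast
  ultimately have "card (commuting_lifts G' \<one>\<^bsub>G\<^esub> \<one>\<^bsub>G\<^esub> q) = 40"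
    by (simp only: card_image card_commuting_pairs_Q8)
  then have classes: "card (q.kernel_orbits \<one>\<^bsub>G\<^esub>) = 5"
    using q.card_commuting_lifts_one[OF fin, of "\<one>\<^bsub>G\<^esub>"] cardN by simp

  define z where "z = \<iota> (-1, 0, 0, 0)"
  have zN: "z \<in> ?N" unfolding N z_def by (auto simp: Q8_def)
  then have zc: "z \<in> carrier G'" by (rule q.kernel_carrier)
  have "z \<noteq> \<iota> \<one>\<^bsub>Q8\<^esub>"
    unfolding z_def by (subst inj_on_eq_iff[OF inj]) (auto simp: Q8_def)
  then have z_one: "z \<noteq> \<one>\<^bsub>G'\<^esub>" by simp
  have "(-1, 0, 0, 0) \<otimes>\<^bsub>Q8\<^esub> (-1, 0, 0, 0) = \<one>\<^bsub>Q8\<^esub>" by (simp add: Q8_def)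
  then have "\<iota> ((-1, 0, 0, 0) \<otimes>\<^bsub>Q8\<^esub> (-1, 0, 0, 0)) = \<one>\<^bsub>G'\<^esub>" by (simp only: i.hom_one)
  then have zz: "z \<otimes>\<^bsub>G'\<^esub> z = \<one>\<^bsub>G'\<^esub>"
    unfolding z_def by (subst (asm) i.hom_mult) (auto simp: Q8_def)
  \<comment> \<open>\<open>-1\<close> is the only element of order two in \<open>Q8\<close>, so its image is central in \<open>G'\<close>.\<close>
  have conj_z: "q.G.conjugate g z = z" if g: "g \<in> carrier G'" for g
  proof -
    have "q.G.conjugate g z \<in> ?N"
      using zN g zc q.hom_conjugate[of g z] by (simp add: kernel_def)
    then obtain w where w: "w \<in> carrier Q8" "q.G.conjugate g z = \<iota> w" unfolding N by blast
    have "q.G.conjugate g z \<otimes>\<^bsub>G'\<^esub> q.G.conjugate g z = g \<otimes>\<^bsub>G'\<^esub> (z \<otimes>\<^bsub>G'\<^esub> z) \<otimes>\<^bsub>G'\<^esub> inv\<^bsub>G'\<^esub> g"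
    proof -
      have "inv\<^bsub>G'\<^esub> g \<otimes>\<^bsub>G'\<^esub> (g \<otimes>\<^bsub>G'\<^esub> y) = y" if "y \<in> carrier G'" for y
        using that g by (simp flip: q.G.m_assoc)
      then show ?thesis
        using g zc by (simp add: q.G.conjugate_def q.G.m_assoc)
    qed
    then have "\<iota> (w \<otimes>\<^bsub>Q8\<^esub> w) = \<iota> \<one>\<^bsub>Q8\<^esub>" using w g zz by simp
    then have "w \<otimes>\<^bsub>Q8\<^esub> w = \<one>\<^bsub>Q8\<^esub>" using inj_onD[OF inj] w by simp
    then have "w = \<one>\<^bsub>Q8\<^esub> \<or> w = (-1, 0, 0, 0)" using w by (auto simp: Q8_def)
    moreover have "w \<noteq> \<one>\<^bsub>Q8\<^esub>"
    proof
      assume "w = \<one>\<^bsub>Q8\<^esub>"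
      then have "q.G.conjugate g z = q.G.conjugate g \<one>\<^bsub>G'\<^esub>"
        using w g by (simp add: q.G.conjugate_def)
      then show False using inj_onD[OF q.G.inj_on_conjugate[OF g]] zc z_one by simp
    qed
    ultimately show ?thesis using w by (simp add: z_def)
  qed
  have conj_1: "q.G.conjugate g \<one>\<^bsub>G'\<^esub> = \<one>\<^bsub>G'\<^esub>" if "g \<in> carrier G'" for g
    using that by (simp add: q.G.conjugate_def)
  let ?F = "{O' \<in> q.kernel_orbits \<one>\<^bsub>G\<^esub>. q.G.conjugate a ` O' = O'}"
  \<comment> \<open>The image of a constant map is a singleton only over a nonempty set.\<close>
  have "?N \<noteq> {}" using zN by blast
  then have "q.kernel_orbit z = {z}" "q.kernel_orbit \<one>\<^bsub>G'\<^esub> = {\<one>\<^bsub>G'\<^esub>}"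
    by (auto simp: q.kernel_orbit_def conj_z conj_1 q.kernel_carrier image_constant_conv
        cong: image_cong_simp)
  then have "{{z}, {\<one>\<^bsub>G'\<^esub>}} \<subseteq> ?F"
    using zN a conj_z conj_1 by (auto simp: q.kernel_orbits_def q.fibre_def kernel_def image_iff)
  then have "card {{z}, {\<one>\<^bsub>G'\<^esub>}} \<le> card ?F" by (intro card_mono) (simp_all add: fin_orbits)
  then have "2 \<le> card ?F" using z_one by simp
  moreover have "card ?F \<le> 5"
    using card_mono[OF fin_orbits, of ?F] classes by fastforce
  \<comment> \<open>Excludes 4: conjugation by \<open>a\<close> permutes the five classes.\<close>
  moreover have "card ?F + 1 \<noteq> 5"
    using card_fixed_points_plus_1_neq_card[OF fin_orbits q.conjugate_permutes_kernel_orbits,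
      of a "\<one>\<^bsub>G\<^esub>"] a assms(2) classes by simp
  \<comment> \<open>Both sides, times 8, count the commuting pairs over \<alpha> and the identity,
    taken in the two orders.\<close>
  moreover have "card ?F = card (q.kernel_orbits \<alpha>)"
    using q.card_commuting_lifts[OF fin, of a \<alpha> "\<one>\<^bsub>G\<^esub>"] q.card_commuting_lifts_one[OF fin, of \<alpha>]
      q.card_commuting_lifts_swap[of \<alpha> "\<one>\<^bsub>G\<^esub>"] a cardN by (simp add: q.fibre_def)
  ultimately have t: "card (q.kernel_orbits \<alpha>) \<in> {2, 3, 5}" by auto

  let ?K = "{O' \<in> q.kernel_orbits \<alpha>. q.G.conjugate b ` O' = O'}"
  have "card ?K \<le> card (q.kernel_orbits \<alpha>)"
    by (rule card_mono[OF fin_orbits]) auto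
  moreover have "card ?K + 1 \<noteq> card (q.kernel_orbits \<alpha>)"
    using card_fixed_points_plus_1_neq_card[OF fin_orbits q.conjugate_permutes_kernel_orbits,
      of b \<alpha>] b assms(4) by simp
  \<comment> \<open>The number of orbits 2 allows 0, 2; 3 allows 0, 1, 3; and 5 allows 0, 1, 2, 3,
    5. The value 4 could only come from 5 orbits, where it is excluded.\<close>
  ultimately have "card ?K \<in> {0, 1, 2, 3, 5}" using t by auto
  moreover have "card (commuting_lifts G' \<alpha> \<beta> q) = 8 * card ?K"
    using q.card_commuting_lifts[OF fin, of b \<beta> \<alpha>] b cardN by (simp add: q.fibre_def)
  moreover have "finite (commuting_lifts G' \<alpha> \<beta> q)"
    using finite_subset[OF q.commuting_lifts_subset] q.finite_fibre[OF fin] by blast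
  ultimately show ?thesis by auto
qed

end
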